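(* Let $\{\hat{\mathbf b}^t\}$ be the real-time decisions, $\hat\phi:=F(\{\hat{\mathbf b}^t\})$ the average aggregate cost they attain, and $\tilde\phi$ the optimal value of the offline aggregate problem, under the standing assumptions of the context. If $\{r^t,c_0^t,c_p^t,c_r^t,\boldsymbol\ell^t,\mathbf q^t\}$ are independent and identically distributed over time, then $$\tilde\phi\le\hat\phi\le\tilde\phi+K,\qquad\text{where } K:=\frac12\sum_{n=1}^Nw_n\max\{\overline b_n^2,\underline b_n^2\}.$$
   Context: Setting. There are $N$ users (one per bus of a radial distribution grid), indexed by $n$, and time periods $t=0,1,2,\dots$. Vector inequalities are entrywise, and $\mathbf 1$ is the all-one vector. At time $t$: $\boldsymbol\ell^t,\mathbf q^t\in\mathbb R^N$ are the (random) active and reactive loads, bounded within known intervals $\underline{\boldsymbol\ell}\le\boldsymbol\ell^t\le\overline{\boldsymbol\ell}$ and $\underline{\mathbf q}\le\mathbf q^t\le\overline{\mathbf q}$; $r^t\in\{-1,+1\}$ is the (random) regulation signal; the (random) prices satisfy $0\le\underline c_0\le c_0^t\le\overline c_0$, $0\le\underline c_p\le c_p^t\le\overline c_p$ and $0\le\underline c_r\le c_r^t\le\overline c_r$. The decisions are the battery charges $\mathbf b^t\in\mathbb R^N$ (positive when charging, negative when discharging), with limits $\underline{\mathbf b}\le\mathbf 0\le\overline{\mathbf b}$; $\mathbf s^t$ is the vector of states of charge, with initial value $\mathbf s^0\in[\underline{\mathbf s},\overline{\mathbf s}]$. The net demand is $\mathbf p^t=\boldsymbol\ell^t+\mathbf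 b^t$, and the per-unit energy price $c_0^t+c_p^t\sum_{i=1}^Np_i^t$ is assumed positive for all $t$. The matrices are $\mathbf R=2(\mathbf A^\top \mathrm{diag}(\rho)^{-1}\mathbf A)^{-1}$ and $\mathbf X=2(\mathbf A^\top \mathrm{diag}(\chi)^{-1}\mathbf A)^{-1}$, where $\mathbf A$ is the (square, invertible) reduced branch-bus incidence matrix of the radial grid and $\rho,\chi$ are the vectors of line resistances and reactances; $\mathbf R,\mathbf X$ have nonnegative entries. The scalars $\alpha,\beta$ are fixed voltage regulation limits. Constraints, for all $t$: (i) $\mathbf s^{t+1}=\mathbf s^t+\mathbf b^t$ and $\underline{\mathbf s}\le\mathbf s^t\le\overline{\mathbf s}$; (ii) $\underline{\mathbf b}\le\mathbf b^t\le\overline{\mathbf b}$; (iii) $\mathbf p^t=\boldsymbol\ell^t+\mathbf b^t$; (iv) $\alpha\mathbf 1\le-\mathbf R\mathbf p^t-\mathbf X\mathbf q^t\le\beta\mathbf 1$; (v) $r^t=\mathrm{sign}(b_n^t)$ for all $n$, understood as: batteries can only be charged ($b_n^t\ge0$) when $r^t=+1$ and only be discharged ($b_n^t\le0$) when $r^t=-1$, with $b_n^t=0$ allowed in both cases. The aggregate cost at time $t$ is $$f^t(\mathbf b^t)=\frac{c_p^t}{2}\Big(\sum_{n=1}^Np_n^t\Big)^2+\sum_{n=1}^N\Big[c_0^tp_n^t+\frac{c_p^t(p_n^t)^2}{2}-r^tc_r^tb_n^t\Big],$$ and $F(\{\mathbf b^t\}):=\lim_{T\to\infty}\frac1T\sum_{t=0}^{T-1}\mathbb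 E[f^t(\mathbf b^t)]$. Offline aggregate problem: $\tilde\phi:=\min F(\{\mathbf b^t\})$ over sequences $\{\mathbf b^t\}$ satisfying (i)–(v) for all $t$. Real-time problem: given parameters $\gamma_n$, positive weights $w_n$ and the virtual queues $x_n^t:=s_n^t+\gamma_n$, where $s_n^t=\hat s_n^t$ is the current state of charge under the real-time decisions ($\hat{\mathbf s}^0=\mathbf s^0$, $\hat{\mathbf s}^{t+1}=\hat{\mathbf s}^t+\hat{\mathbf b}^t$), the real-time decision $\hat{\mathbf b}^t$ is the minimizer of $\sum_{n=1}^Nw_nx_n^tb_n^t+f^t(\mathbf b^t)$ over $\mathbf b^t$ subject to (ii)–(v) only. Standing assumptions. (a1) $\overline s_n-\underline s_n>\overline b_n-\underline b_n$ for all $n$. (a2) $\alpha\mathbf 1\le-\mathbf R\boldsymbol\ell^t-\mathbf X\mathbf q^t\le\beta\mathbf 1$ for all $t$. The parameters are tuned so that the real-time decisions are feasible for the offline aggregate problem, namely, for all $n$, $w_n\delta_n\ge1$ and $-\frac{\underline g_n}{w_n}+\overline b_n-\overline s_n\le\gamma_n\le-\frac{\overline g_n}{w_n}+\underline b_n-\underline s_n$, where $\underline g_n:=\underline c_0+\frac{\underline c_p}{N}\underline{\boldsymbol\ell}^\top\mathbf 1+\frac{\underline c_p}{N}\underline\ell_n-\overline c_r$, $\overline g_n:=\overline c_0+\frac{\overline c_p}{N}\overline{\boldsymbol\ell}^\top\mathbf 1+\frac{\overline c_p}{N}\overline\ell_n+\overline c_r$, and $\delta_n:=(\overline s_n-\underline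 s_n+\underline b_n-\overline b_n)/(\overline g_n-\underline g_n)>0$. *)

theory Defs
  imports "HOL-Probability.Probability"
begin

section \<open>Radial grid\<close>

text \<open>
  The buses are the elements of \<open>'n option\<close>: \<open>None\<close> is the substation, \<open>Some n\<close> the bus of user
  \<open>n\<close>. A tree on these \<open>N + 1\<close> buses has \<open>N\<close> lines, so the lines are indexed by \<open>'n\<close> as well;
  \<open>src k\<close> and \<open>dst k\<close> are the ends of line \<open>k\<close> in an arbitrary orientation. The labelling of
  the lines is unrelated to that of the users.
\<close>

definition joined_by :: "('n \<Rightarrow> 'n option) \<Rightarrow> ('n \<Rightarrow> 'n option) \<Rightarrow> 'n set \<Rightarrow> ('n option \<times> 'n option) set" where
  "joined_by src dst L = (\<Union>k\<in>L. {(src k, dst k), (dst k, src k)})\<^sup>*"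

text \<open>
  The second conjunct says that there is no cycle: the ends of a line are not joined by the
  other lines.
\<close>

definition radial :: "('n \<Rightarrow> 'n option) \<Rightarrow> ('n \<Rightarrow> 'n option) \<Rightarrow> bool" where
  "radial src dst \<longleftrightarrow>
     (\<forall>u v. (u, v) \<in> joined_by src dst UNIV) \<and>
     (\<forall>k. (src k, dst k) \<notin> joined_by src dst (UNIV - {k}))"

text \<open>
  Reduced incidence matrix: one row per line, one column per user; the column of the substation
  is dropped.
\<close>

definition incidence :: "('n \<Rightarrow> 'n option) \<Rightarrow> ('n \<Rightarrow> 'n option) \<Rightarrow> real ^ 'n ^ 'n" where
  "incidence src dst = (\<chi> k n. of_bool (src k = Some n) - of_bool (dst k = Some n))"

definition diag :: "real ^ 'n \<Rightarrow> real ^ 'n ^ 'n" where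
  "diag v = (\<chi> i j. if i = j then v $ i else 0)"

definition sensitivity :: "real ^ 'n ^ 'n \<Rightarrow> real ^ 'n \<Rightarrow> real ^ 'n ^ 'n" where
  "sensitivity A z = 2 *\<^sub>R matrix_inv (transpose A ** matrix_inv (diag z) ** A)"


section \<open>One period\<close>

text \<open>The constraints on the battery charges other than those on the states of charge.\<close>

definition admissible ::
  "real ^ 'n ^ 'n \<Rightarrow> real ^ 'n ^ 'n \<Rightarrow> real \<Rightarrow> real \<Rightarrow> real ^ 'n \<Rightarrow> real ^ 'n
    \<Rightarrow> real \<Rightarrow> real ^ 'n \<Rightarrow> real ^ 'n \<Rightarrow> (real ^ 'n) set" where
  "admissible R X \<alpha> \<beta> b_lo b_hi r l q =
     {b. b_lo \<le> b \<and> b \<le> b_hi \<and>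
         vec \<alpha> \<le> - (R *v (l + b)) - X *v q \<and> - (R *v (l + b)) - X *v q \<le> vec \<beta> \<and>
         (\<forall>n. (r = 1 \<longrightarrow> 0 \<le> b $ n) \<and> (r = -1 \<longrightarrow> b $ n \<le> 0))}"

definition aggregate_cost ::
  "real \<Rightarrow> real \<Rightarrow> real \<Rightarrow> real \<Rightarrow> real ^ 'n \<Rightarrow> real ^ 'n \<Rightarrow> real" where
  "aggregate_cost r c0 cp cr l b =
     (let p = l + b in
        cp / 2 * (\<Sum>n\<in>UNIV. p $ n)\<^sup>2 +
        (\<Sum>n\<in>UNIV. c0 * p $ n + cp * (p $ n)\<^sup>2 / 2 - r * cr * b $ n))"


section \<open>Decision processes\<close>

primrec soc :: "real ^ 'n \<Rightarrow> (nat \<Rightarrow> 'w \<Rightarrow> real ^ 'n) \<Rightarrow> nat \<Rightarrow> 'w \<Rightarrow> real ^ 'n" where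
  "soc s0 b 0 \<omega> = s0"
| "soc s0 b (Suc t) \<omega> = soc s0 b t \<omega> + b t \<omega>"

text \<open>
  In what follows \<open>f t \<omega>\<close> is the cost function of period \<open>t\<close> and \<open>C t \<omega>\<close> the set of
  admissible charges in that period.
\<close>

definition mean_cost ::
  "'w measure \<Rightarrow> (nat \<Rightarrow> 'w \<Rightarrow> real ^ 'n \<Rightarrow> real) \<Rightarrow> (nat \<Rightarrow> 'w \<Rightarrow> real ^ 'n) \<Rightarrow> nat \<Rightarrow> real" where
  "mean_cost M f b T = 1 / real T * (\<Sum>t<T. \<integral>\<omega>. f t \<omega> (b t \<omega>) \<partial>M)"

text \<open>Meaningful only if \<open>convergent (mean_cost M f b)\<close>.\<close>

definition long_run_cost ::
  "'w measure \<Rightarrow> (nat \<Rightarrow> 'w \<Rightarrow> real ^ 'n \<Rightarrow> real) \<Rightarrow> (nat \<Rightarrow> 'w \<Rightarrow> real ^ 'n) \<Rightarrow> real" where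
  "long_run_cost M f b = lim (mean_cost M f b)"

text \<open>
  Offline decisions may depend on the entire realization, future periods included.
\<close>

definition offline_feasible ::
  "'w measure \<Rightarrow> (nat \<Rightarrow> 'w \<Rightarrow> (real ^ 'n) set) \<Rightarrow> real ^ 'n \<Rightarrow> real ^ 'n \<Rightarrow> real ^ 'n
    \<Rightarrow> (nat \<Rightarrow> 'w \<Rightarrow> real ^ 'n) \<Rightarrow> bool" where
  "offline_feasible M C s_lo s_hi s0 b \<longleftrightarrow>
     (\<forall>t. b t \<in> borel_measurable M) \<and>
     (AE \<omega> in M. \<forall>t. s_lo \<le> soc s0 b t \<omega> \<and> soc s0 b t \<omega> \<le> s_hi \<and> b t \<omega> \<in> C t \<omega>)"

definition offline_value ::
  "'w measure \<Rightarrow> (nat \<Rightarrow> 'w \<Rightarrow> real ^ 'n \<Rightarrow> real) \<Rightarrow> (nat \<Rightarrow> 'w \<Rightarrow> (real ^ 'n) set)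
    \<Rightarrow> real ^ 'n \<Rightarrow> real ^ 'n \<Rightarrow> real ^ 'n \<Rightarrow> real" where
  "offline_value M f C s_lo s_hi s0 =
     Inf (long_run_cost M f ` {b. offline_feasible M C s_lo s_hi s0 b \<and> convergent (mean_cost M f b)})"

text \<open>The sigma-algebra generated by \<open>\<xi> 0, \<dots>, \<xi> t\<close>.\<close>

definition history :: "'w measure \<Rightarrow> (nat \<Rightarrow> 'w \<Rightarrow> 'a::topological_space) \<Rightarrow> nat \<Rightarrow> 'w measure" where
  "history M \<xi> t =
     vimage_algebra (space M) (\<lambda>\<omega>. \<lambda>i\<in>{..t}. \<xi> i \<omega>) (Pi\<^sub>M {..t} (\<lambda>_. borel))"

text \<open>
  The minimizer need not be unique when the cost is not strictly convex; any selection that uses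
  only the data observed so far is allowed.
\<close>

definition real_time_decisions ::
  "'w measure \<Rightarrow> (nat \<Rightarrow> 'w \<Rightarrow> 'a::topological_space) \<Rightarrow> (nat \<Rightarrow> 'w \<Rightarrow> real ^ 'n \<Rightarrow> real)
    \<Rightarrow> (nat \<Rightarrow> 'w \<Rightarrow> (real ^ 'n) set) \<Rightarrow> real ^ 'n \<Rightarrow> real ^ 'n \<Rightarrow> real ^ 'n
    \<Rightarrow> (nat \<Rightarrow> 'w \<Rightarrow> real ^ 'n) \<Rightarrow> bool" where
  "real_time_decisions M \<xi> f C w \<gamma> s0 b \<longleftrightarrow>
     (\<forall>t. b t \<in> borel_measurable (history M \<xi> t)) \<and>
     (AE \<omega> in M. \<forall>t.
        is_arg_min (\<lambda>u. (\<Sum>n\<in>UNIV. w $ n * (soc s0 b t \<omega> $ n + \<gamma> $ n) * u $ n) + f t \<omega> u)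
                   (\<lambda>u. u \<in> C t \<omega>) (b t \<omega>))"

end

(* Drift-plus-penalty argument. With x = s + gamma and Lyapunov function V(x) = 1/2 * sum w_n x_n^2,
   one period changes V by at most K + sum w_n x_n b_n. The real-time rule minimizes
   sum w_n x_n b_n + f(b), so cost plus drift of the real-time decisions is at most K plus the least
   penalized cost v(x, xi) of the current state and data. The state depends on past data only, hence
   is independent of xi_t; and for each fixed x the mean of v(x, xi_t) equals that of v(x, xi_s) for
   every s, which is bounded through the offline decision b_s of period s, however anticipating it is.
   Averaging over s < T, the mean offline charge is O(1/T) because the states of charge are bounded, so
   the penalty term vanishes. Comparing period t with all offline periods s in this way replaces the
   construction of an optimal stationary randomized policy. *)

theory Submission
  imports Defs
begin

section \<open>Parametric minimization over the sections of a closed set\<close>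

text \<open>The value function of a minimization with parameter \<open>a\<close>. The constraint is
  one set of pairs, so that closedness can be required jointly in parameter and variable.\<close>

definition partial_min :: "('a \<times> 'b \<Rightarrow> real) \<Rightarrow> ('a \<times> 'b) set \<Rightarrow> 'a \<Rightarrow> real" where
  "partial_min h S a = Inf ((\<lambda>b. h (a, b)) ` {b. (a, b) \<in> S})"

lemma partial_min_eq:
  assumes "(a, b) \<in> S" "\<And>b'. (a, b') \<in> S \<Longrightarrow> h (a, b) \<le> h (a, b')"
  shows "partial_min h S a = h (a, b)"
  unfolding partial_min_def by (rule cInf_eq_minimum) (use assms in auto)

text \<open>The section of \<open>S\<close> at \<open>a\<close> is a closed part of the compact
  \<open>U\<close>, and \<open>b\<close> shows that it is nonempty, so \<open>h\<close> attains its
  minimum there. The last conclusion lets any admissible \<open>b\<close> serve as a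
  competitor.\<close>

lemma partial_min_attained:
  fixes h :: "'a::t1_space \<times> 'b::t2_space \<Rightarrow> real"
  assumes "compact U" "closed S" "continuous_on UNIV h" "snd ` S \<subseteq> U"
    and "(a, b) \<in> S"
  obtains b' where "(a, b') \<in> S" "partial_min h S a = h (a, b')" "h (a, b') \<le> h (a, b)"
proof -
  let ?B = "{b. (a, b) \<in> S}"
  have "closed ?B"
    using closed_vimage[OF assms(2), of "Pair a"] by (simp add: vimage_def continuous_intros)
  then have "compact (U \<inter> ?B)"
    by (rule compact_Int_closed[OF assms(1)])
  moreover have "U \<inter> ?B = ?B"
    using assms(4) by force
  ultimately have "compact ?B"
    by simp
  moreover have "continuous_on ?B (\<lambda>b. h (a, b))"
    by (intro continuous_on_compose2[OF assms(3)] continuous_intros) auto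
  ultimately obtain b' where b': "b' \<in> ?B" "\<forall>c\<in>?B. h (a, b') \<le> h (a, c)"
    using continuous_attains_inf[of ?B "\<lambda>b. h (a, b)"] assms(5) by auto
  show thesis
    by (rule that[of b']) (use b' assms(5) in \<open>auto intro!: partial_min_eq\<close>)
qed

text \<open>Projection along a compact factor is a closed map. The swap puts the compact variable
  first, as \<open>closed_compact_projection\<close> has it.\<close>

lemma closed_fst_image:
  fixes S :: "('a::euclidean_space \<times> 'b::euclidean_space) set"
  assumes "compact U" "closed S" "snd ` S \<subseteq> U"
  shows "closed (fst ` S)"
proof -
  have "closed (prod.swap -` S)"
    by (intro closed_vimage assms) (auto intro!: continuous_intros simp: prod.swap_def)
  then have "closed {a. \<exists>b. b \<in> U \<and> (b, a) \<in> prod.swap -` S}"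
    by (rule closed_compact_projection[OF assms(1)])
  also have "{a. \<exists>b. b \<in> U \<and> (b, a) \<in> prod.swap -` S} = fst ` S"
    using assms(3) by force
  finally show ?thesis .
qed

text \<open>The minimum is lower semicontinuous on its domain, since the projection along the compact
  set \<open>U\<close> maps closed sets to closed sets; outside the domain it has the junk value \<open>Inf {}\<close>.\<close>

lemma borel_measurable_partial_min:
  fixes h :: "'a::euclidean_space \<times> 'b::euclidean_space \<Rightarrow> real"
  assumes "compact U" "closed S" "continuous_on UNIV h" "snd ` S \<subseteq> U"
  shows "partial_min h S \<in> borel_measurable borel"
  unfolding borel_measurable_iff_le
proof
  fix c
  have "closed (S \<inter> {p. h p \<le> c})"
    by (intro closed_Int assms closed_Collect_le continuous_intros)
  then have 1: "closed (fst ` (S \<inter> {p. h p \<le> c}))"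
    by (rule closed_fst_image[OF assms(1)]) (use assms(4) in auto)
  have 2: "closed (fst ` S)"
    by (rule closed_fst_image[OF assms(1,2,4)])
  have junk: "partial_min h S a = Inf {}" if "a \<notin> fst ` S" for a
  proof -
    have "{b. (a, b) \<in> S} = {}"
      using that by force
    then show ?thesis
      by (simp add: partial_min_def)
  qed
  \<comment> \<open>Attainment is essential here: an infimum at most \<open>c\<close> that is not
    attained would provide no point of \<open>S\<close> with \<open>h\<close> at most
    \<open>c\<close>.\<close>
  have dom: "partial_min h S a \<le> c \<longleftrightarrow> a \<in> fst ` (S \<inter> {p. h p \<le> c})" if a: "a \<in> fst ` S" for a
  proof
    assume le: "partial_min h S a \<le> c"
    from a obtain b where "(a, b) \<in> S"
      by auto
    then obtain b' where "(a, b') \<in> S" "partial_min h S a = h (a, b')"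
      using partial_min_attained[OF assms] by metis
    with le show "a \<in> fst ` (S \<inter> {p. h p \<le> c})"
      by force
  next
    assume "a \<in> fst ` (S \<inter> {p. h p \<le> c})"
    then obtain b where "(a, b) \<in> S" "h (a, b) \<le> c"
      by auto
    then show "partial_min h S a \<le> c"
      using partial_min_attained[OF assms] by (metis order_trans)
  qed
  have "{a. partial_min h S a \<le> c} =
      fst ` (S \<inter> {p. h p \<le> c}) \<union> (if Inf {} \<le> c then - fst ` S else {})"
    using junk dom by (fastforce split: if_splits)
  also have "\<dots> \<in> sets borel"
    using 1 2 by auto
  finally show "{a \<in> space borel. partial_min h S a \<le> c} \<in> sets borel"
    by simp
qed

section \<open>Histories, states of charge and independence of the past\<close>

text \<open>The data up to \<open>s\<close> are a coordinate restriction of the data up to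
  \<open>t\<close>, hence a measurable function of them.\<close>

lemma measurable_history_mono:
  assumes "s \<le> t"
  shows "measurable (history M \<xi> s) N \<subseteq> measurable (history M \<xi> t) N"
proof -
  have "(\<lambda>\<omega>. \<lambda>i\<in>{..t}. \<xi> i \<omega>) \<in> measurable (history M \<xi> t) (Pi\<^sub>M {..t} (\<lambda>_. borel))"
    unfolding history_def by (rule measurable_vimage_algebra1) (auto simp: space_PiM)
  then have "(\<lambda>\<omega>. restrict (\<lambda>i\<in>{..t}. \<xi> i \<omega>) {..s}) \<in> measurable (history M \<xi> t) (Pi\<^sub>M {..s} (\<lambda>_. borel))"
    by (rule measurable_compose) (use assms in \<open>intro measurable_restrict_subset, auto\<close>)
  moreover have "restrict (\<lambda>i\<in>{..t}. \<xi> i \<omega>) {..s} = (\<lambda>i\<in>{..s}. \<xi> i \<omega>)" for \<omega>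
    using assms by (auto simp: fun_eq_iff)
  ultimately have "(\<lambda>\<omega>. \<lambda>i\<in>{..s}. \<xi> i \<omega>) \<in> measurable (history M \<xi> t) (Pi\<^sub>M {..s} (\<lambda>_. borel))"
    by simp
  then have "(\<lambda>\<omega>. \<omega>) \<in> measurable (history M \<xi> t) (history M \<xi> s)"
    unfolding history_def[of M \<xi> s] by (intro measurable_vimage_algebra2) (auto simp: history_def)
  then show ?thesis
    using measurable_compose[of "\<lambda>\<omega>. \<omega>"] by blast
qed

text \<open>Only decisions strictly before \<open>t\<close> enter the state of period
  \<open>t\<close>; this strictness later separates the state from the data of period
  \<open>t\<close>.\<close>

lemma borel_measurable_soc:
  assumes "\<And>s. s < t \<Longrightarrow> b s \<in> borel_measurable N"
  shows "soc s0 b t \<in> borel_measurable N"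
  using assms
proof (induction t)
  case 0
  have "soc s0 b 0 = (\<lambda>_. s0)"
    by (simp add: fun_eq_iff)
  then show ?case
    by simp
next
  case (Suc t)
  have "soc s0 b (Suc t) = (\<lambda>\<omega>. soc s0 b t \<omega> + b t \<omega>)"
    by (simp add: fun_eq_iff)
  with Suc show ?case
    by simp
qed

lemma soc_eq_sum: "soc s0 b t \<omega> = s0 + (\<Sum>s<t. b s \<omega>)"
  by (induction t) (simp_all add: algebra_simps)

lemma borel_measurable_vec_nth[measurable (raw)]:
  fixes b :: "'c \<Rightarrow> real ^ 'n"
  shows "b \<in> borel_measurable N \<Longrightarrow> (\<lambda>\<omega>. b \<omega> $ n) \<in> borel_measurable N"
  by (rule borel_measurable_continuous_on[of "\<lambda>x. x $ n"]) (auto intro: continuous_intros)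

text \<open>Continuous functions are bounded on compact sets, and bounded measurable functions are
  integrable for a finite measure. Integrability of costs, charges and queues rests on this.\<close>

lemma (in finite_measure) integrable_continuous_compact:
  fixes h :: "'b::topological_space \<Rightarrow> real"
  assumes "continuous_on UNIV h" "compact P" "X \<in> borel_measurable M" "AE \<omega> in M. X \<omega> \<in> P"
  shows "integrable M (\<lambda>\<omega>. h (X \<omega>))"
proof -
  have "bounded (h ` P)"
    by (intro compact_imp_bounded compact_continuous_image continuous_on_subset[OF assms(1)] assms(2)) simp
  then obtain B where B: "\<And>x. x \<in> P \<Longrightarrow> norm (h x) \<le> B"
    unfolding bounded_iff by auto
  show ?thesis
  proof (rule integrable_const_bound[of _ B])
    show "AE \<omega> in M. norm (h (X \<omega>)) \<le> B"
      using assms(4) by eventually_elim (rule B)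
  qed (rule borel_measurable_continuous_on[OF assms(1,3)])
qed

text \<open>The data blocks indexed by \<open>I\<close> and \<open>{j}\<close> are independent, and
  the events of \<open>X\<close> lie in the sigma-algebra of the first block. Rectangles determine
  the product measure, so the joint law factors.\<close>

lemma (in prob_space) distr_pair_past:
  fixes \<xi> :: "nat \<Rightarrow> 'a \<Rightarrow> 'b::topological_space"
  assumes ind: "indep_vars (\<lambda>_. borel) \<xi> UNIV"
    and X: "X \<in> measurable (vimage_algebra (space M) (\<lambda>\<omega>. \<lambda>i\<in>I. \<xi> i \<omega>) (Pi\<^sub>M I (\<lambda>_. borel))) N"
    and j: "j \<notin> I"
  shows "distr M (N \<Otimes>\<^sub>M borel) (\<lambda>\<omega>. (X \<omega>, \<xi> j \<omega>)) = distr M N X \<Otimes>\<^sub>M distr M borel (\<xi> j)"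
proof -
  let ?A = "vimage_algebra (space M) (\<lambda>\<omega>. \<lambda>i\<in>I. \<xi> i \<omega>) (Pi\<^sub>M I (\<lambda>_. borel))"
  let ?H = "\<lambda>\<omega>. \<lambda>i\<in>I. \<xi> i \<omega>" and ?P = "Pi\<^sub>M I (\<lambda>_. borel :: 'b measure)"
  let ?F = "\<lambda>\<omega>. \<lambda>i\<in>{j}. \<xi> i \<omega>" and ?Q = "Pi\<^sub>M {j} (\<lambda>_. borel :: 'b measure)"
  have rv[measurable]: "random_variable borel (\<xi> i)" for i
    using ind by (auto simp: indep_vars_def)
  have H: "?H \<in> measurable M ?P"
    using rv by (intro measurable_restrict) auto
  then have "(\<lambda>\<omega>. \<omega>) \<in> measurable M ?A"
    by (intro measurable_vimage_algebra2) auto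
  from measurable_compose[OF this X] have XM[measurable]: "X \<in> measurable M N"
    by simp
  have "indep_var ?P ?H ?Q ?F"
    by (rule indep_var_restrict[OF ind]) (use j in auto)
  \<comment> \<open>Independence is used on generated events, which avoids factoring
    \<open>X\<close> through the block \<open>?H\<close>.\<close>
  then have prod: "prob (A \<inter> B) = prob A * prob B"
    if "A \<in> sigma_sets (space M) {?H -` A \<inter> space M |A. A \<in> sets ?P}"
      "B \<in> sigma_sets (space M) {?F -` B \<inter> space M |B. B \<in> sets ?Q}" for A B
    using that unfolding indep_var_eq indep_sets2_eq by blast
  interpret X: prob_space "distr M N X"
    by (rule prob_space_distr) fact
  interpret Y: prob_space "distr M borel (\<xi> j)"
    by (rule prob_space_distr) fact
  show ?thesis
  proof (rule pair_measure_eqI[symmetric])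
    fix A B assume "A \<in> sets (distr M N X)" "B \<in> sets (distr M borel (\<xi> j))"
    then have A[measurable]: "A \<in> sets N" and B[measurable]: "B \<in> sets borel"
      by auto
    have "X -` A \<inter> space M \<in> sets ?A"
      using measurable_sets[OF X A] by simp
    then have 1: "X -` A \<inter> space M \<in> sigma_sets (space M) {?H -` A \<inter> space M |A. A \<in> sets ?P}"
      by (simp add: sets_vimage_algebra)
    have "(\<lambda>g. g j) -` B \<inter> space ?Q \<in> sets ?Q"
      by (rule measurable_sets[OF _ B]) (auto intro: measurable_component_singleton)
    moreover have "\<xi> j -` B \<inter> space M = ?F -` ((\<lambda>g. g j) -` B \<inter> space ?Q) \<inter> space M"
      by (auto simp: space_PiM)
    ultimately have 2: "\<xi> j -` B \<inter> space M \<in> sigma_sets (space M) {?F -` B \<inter> space M |B. B \<in> sets ?Q}"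
      by (intro sigma_sets.Basic) blast
    have "(\<lambda>\<omega>. (X \<omega>, \<xi> j \<omega>)) -` (A \<times> B) \<inter> space M =
        (X -` A \<inter> space M) \<inter> (\<xi> j -` B \<inter> space M)"
      by auto
    then show "emeasure (distr M N X) A * emeasure (distr M borel (\<xi> j)) B =
        emeasure (distr M (N \<Otimes>\<^sub>M borel) (\<lambda>\<omega>. (X \<omega>, \<xi> j \<omega>))) (A \<times> B)"
      using prod[OF 1 2] by (simp add: emeasure_distr emeasure_eq_measure ennreal_mult[symmetric])
  qed (simp_all add: X.sigma_finite_measure_axioms Y.sigma_finite_measure_axioms cong: sets_pair_measure_cong)
qed

section \<open>Stochastic control with independent, identically distributed data\<close>

text \<open>This isolates what the drift argument asks of the grid. Compactness supplies the bounds
  for integrability and, together with closedness of \<open>G\<close>, the measurability of the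
  least penalized cost.\<close>

locale iid_control = prob_space M for M :: "'w measure" +
  fixes \<xi> :: "nat \<Rightarrow> 'w \<Rightarrow> 'a::euclidean_space"
    and \<phi> :: "'a \<times> (real ^ 'n) \<Rightarrow> real"
    and G :: "('a \<times> (real ^ 'n)) set"
    and Z :: "'a set"
    and U :: "(real ^ 'n) set"
    and w :: "real ^ 'n"
  assumes indep: "indep_vars (\<lambda>_. borel) \<xi> UNIV"
    and ident: "\<And>t. distr M borel (\<xi> t) = distr M borel (\<xi> 0)"
    and continuous_\<phi>: "continuous_on UNIV \<phi>"
    and closed_G: "closed G" and G_sub: "snd ` G \<subseteq> U"
    and compact_U: "compact U" and compact_Z: "compact Z"
    and data_in: "AE \<omega> in M. \<forall>t. \<xi> t \<omega> \<in> Z"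
    and w_pos: "\<And>n. 0 < w $ n"
begin

text \<open>State and data form the inner pair because together they are the parameter of
  \<open>partial_min\<close>; the outer second component is the decision minimized over.\<close>

definition penalized :: "((real ^ 'n) \<times> 'a) \<times> (real ^ 'n) \<Rightarrow> real" where
  "penalized p = (\<Sum>n\<in>UNIV. w $ n * fst (fst p) $ n * snd p $ n) + \<phi> (snd (fst p), snd p)"

definition least_penalized :: "(real ^ 'n) \<times> 'a \<Rightarrow> real" where
  "least_penalized = partial_min penalized {p. (snd (fst p), snd p) \<in> G}"

lemma rv_\<xi>[measurable]: "\<xi> t \<in> borel_measurable M"
  using indep by (auto simp: indep_vars_def)

lemma continuous_penalized: "continuous_on UNIV penalized"
  unfolding penalized_def
  by (intro continuous_intros continuous_on_compose2[OF continuous_\<phi>]) auto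

lemma closed_state_graph: "closed {p :: ((real ^ 'n) \<times> 'a) \<times> (real ^ 'n). (snd (fst p), snd p) \<in> G}"
  using closed_vimage[OF closed_G, of "\<lambda>p :: ((real ^ 'n) \<times> 'a) \<times> (real ^ 'n). (snd (fst p), snd p)"]
  by (simp add: vimage_def continuous_intros)

lemma state_graph_sub: "snd ` {p :: ((real ^ 'n) \<times> 'a) \<times> (real ^ 'n). (snd (fst p), snd p) \<in> G} \<subseteq> U"
  using G_sub by force

lemmas state_graph = compact_U closed_state_graph continuous_penalized state_graph_sub

lemma borel_measurable_least_penalized[measurable]: "least_penalized \<in> borel_measurable borel"
  unfolding least_penalized_def by (rule borel_measurable_partial_min[OF state_graph])

lemma least_penalized_attained:
  assumes "(z, u) \<in> G"
  obtains u' where "(z, u') \<in> G" "least_penalized (x, z) = penalized ((x, z), u')"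
    "least_penalized (x, z) \<le> penalized ((x, z), u)"
  using partial_min_attained[OF state_graph, of "(x, z)" u] assms
  unfolding least_penalized_def by (metis (no_types, lifting) fst_conv mem_Collect_eq snd_conv)

lemma least_penalized_eq:
  assumes "(z, u) \<in> G" "\<And>u'. (z, u') \<in> G \<Longrightarrow> penalized ((x, z), u) \<le> penalized ((x, z), u')"
  shows "least_penalized (x, z) = penalized ((x, z), u)"
  unfolding least_penalized_def by (rule partial_min_eq) (use assms in auto)

text \<open>The second bound follows from the first, since the minimum is attained at an admissible
  decision, which lies in \<open>U\<close>. The premise \<open>(z, u) \<in> G\<close> excludes the
  junk value of an empty section.\<close>

lemma penalized_bounded:
  assumes "compact P"
  obtains B where "\<And>x z u. x \<in> P \<Longrightarrow> z \<in> Z \<Longrightarrow> u \<in> U \<Longrightarrow> \<bar>penalized ((x, z), u)\<bar> \<le> B"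
    and "\<And>x z u. x \<in> P \<Longrightarrow> z \<in> Z \<Longrightarrow> (z, u) \<in> G \<Longrightarrow> \<bar>least_penalized (x, z)\<bar> \<le> B"
proof -
  have "compact (penalized ` ((P \<times> Z) \<times> U))"
    by (intro compact_continuous_image continuous_on_subset[OF continuous_penalized] compact_Times
        assms compact_U compact_Z) auto
  then have "bounded (penalized ` ((P \<times> Z) \<times> U))"
    by (rule compact_imp_bounded)
  then obtain B where B: "\<And>y. y \<in> penalized ` ((P \<times> Z) \<times> U) \<Longrightarrow> \<bar>y\<bar> \<le> B"
    unfolding bounded_iff by auto
  show thesis
  proof (rule that[of B])
    show 1: "\<bar>penalized ((x, z), u)\<bar> \<le> B" if "x \<in> P" "z \<in> Z" "u \<in> U" for x z u
      by (rule B) (use that in auto)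
    show "\<bar>least_penalized (x, z)\<bar> \<le> B" if zu: "x \<in> P" "z \<in> Z" "(z, u) \<in> G" for x z u
    proof -
      obtain u' where "(z, u') \<in> G" "least_penalized (x, z) = penalized ((x, z), u')"
        using least_penalized_attained[OF zu(3)] by metis
      with 1[of x z u'] zu G_sub show ?thesis
        by force
    qed
  qed
qed

lemma cost_bounded:
  obtains B where "\<And>z u. z \<in> Z \<Longrightarrow> u \<in> U \<Longrightarrow> \<bar>\<phi> (z, u)\<bar> \<le> B"
proof -
  \<comment> \<open>With queue \<open>0\<close> the penalty term vanishes and
    \<open>penalized\<close> is the bare cost.\<close>
  obtain B where "\<And>z u. z \<in> Z \<Longrightarrow> u \<in> U \<Longrightarrow> \<bar>penalized ((0, z), u)\<bar> \<le> B"
    using penalized_bounded[of "{0}"] by (metis compact_sing singletonI)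
  then show thesis
    by (intro that[of B]) (simp add: penalized_def)
qed

text \<open>Measurability is asked with respect to \<open>M\<close>, not the history, so that
  anticipating offline decisions are covered.\<close>

definition decision :: "nat \<Rightarrow> ('w \<Rightarrow> real ^ 'n) \<Rightarrow> bool" where
  "decision t b \<longleftrightarrow> b \<in> borel_measurable M \<and> (AE \<omega> in M. (\<xi> t \<omega>, b \<omega>) \<in> G)"

lemma decision_measurable: "decision t b \<Longrightarrow> b \<in> borel_measurable M"
  by (simp add: decision_def)

lemma AE_decision:
  assumes "decision t b"
  shows "AE \<omega> in M. \<xi> t \<omega> \<in> Z \<and> (\<xi> t \<omega>, b \<omega>) \<in> G \<and> b \<omega> \<in> U"
proof -
  have "AE \<omega> in M. (\<xi> t \<omega>, b \<omega>) \<in> G"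
    using assms by (simp add: decision_def)
  with data_in show ?thesis
    by eventually_elim (use G_sub in force)
qed

lemma measurable_data_decision:
  assumes "decision t b"
  shows "(\<lambda>\<omega>. (\<xi> t \<omega>, b \<omega>)) \<in> borel_measurable M"
  using decision_measurable[OF assms] by (simp add: borel_prod[symmetric])

lemma integrable_cost:
  assumes "decision t b"
  shows "integrable M (\<lambda>\<omega>. \<phi> (\<xi> t \<omega>, b \<omega>))"
  by (rule integrable_continuous_compact[OF continuous_\<phi> compact_Times[OF compact_Z compact_U]
        measurable_data_decision[OF assms]])
    (use AE_decision[OF assms] in auto)

lemma integrable_decision: "decision t b \<Longrightarrow> integrable M (\<lambda>\<omega>. b \<omega> $ n)"
  by (rule integrable_continuous_compact[OF _ compact_U decision_measurable])
    (auto dest: AE_decision intro: continuous_intros)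

text \<open>Here \<open>t\<close> and \<open>s\<close> are unrelated: only the common law of the data matters, so an offline decision
  of any period \<open>s\<close> can be played against the state of period \<open>t\<close>.\<close>

lemma least_penalized_mean_le:
  assumes "decision s b"
  shows "(\<integral>z. least_penalized (x, z) \<partial>distr M borel (\<xi> t)) \<le>
    (\<Sum>n\<in>UNIV. w $ n * x $ n * (\<integral>\<omega>. b \<omega> $ n \<partial>M)) + (\<integral>\<omega>. \<phi> (\<xi> s \<omega>, b \<omega>) \<partial>M)"
proof -
  obtain B where B: "\<And>z u. z \<in> Z \<Longrightarrow> (z, u) \<in> G \<Longrightarrow> \<bar>least_penalized (x, z)\<bar> \<le> B"
    using penalized_bounded[of "{x}"] by (metis compact_sing singletonI)
  have meas: "(\<lambda>z. least_penalized (x, z)) \<in> borel_measurable borel"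
    by (simp add: borel_prod[symmetric])
  have "(\<integral>z. least_penalized (x, z) \<partial>distr M borel (\<xi> t)) = (\<integral>z. least_penalized (x, z) \<partial>distr M borel (\<xi> s))"
    by (metis ident)
  also have "\<dots> = (\<integral>\<omega>. least_penalized (x, \<xi> s \<omega>) \<partial>M)"
    by (rule integral_distr[OF rv_\<xi> meas])
  also have "\<dots> \<le> (\<integral>\<omega>. (\<Sum>n\<in>UNIV. w $ n * x $ n * b \<omega> $ n) + \<phi> (\<xi> s \<omega>, b \<omega>) \<partial>M)"
  proof (rule integral_mono_AE)
    show "integrable M (\<lambda>\<omega>. least_penalized (x, \<xi> s \<omega>))"
    proof (rule integrable_const_bound[of _ B])
      show "AE \<omega> in M. norm (least_penalized (x, \<xi> s \<omega>)) \<le> B"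
        using AE_decision[OF assms] by eventually_elim (use B in auto)
      show "(\<lambda>\<omega>. least_penalized (x, \<xi> s \<omega>)) \<in> borel_measurable M"
        by (rule measurable_compose[OF rv_\<xi> meas])
    qed
    show "integrable M (\<lambda>\<omega>. (\<Sum>n\<in>UNIV. w $ n * x $ n * b \<omega> $ n) + \<phi> (\<xi> s \<omega>, b \<omega>))"
      using assms by (intro Bochner_Integration.integrable_add Bochner_Integration.integrable_sum
          integrable_mult_right integrable_decision integrable_cost)
    \<comment> \<open>The comparison is pointwise with \<open>x\<close> constant, so
      \<open>b\<close> may depend on \<open>\<xi> s\<close> and on all other data in any
      way.\<close>
    show "AE \<omega> in M. least_penalized (x, \<xi> s \<omega>) \<le> (\<Sum>n\<in>UNIV. w $ n * x $ n * b \<omega> $ n) + \<phi> (\<xi> s \<omega>, b \<omega>)"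
      using AE_decision[OF assms]
    proof eventually_elim
      case (elim \<omega>)
      then have "least_penalized (x, \<xi> s \<omega>) \<le> penalized ((x, \<xi> s \<omega>), b \<omega>)"
        using least_penalized_attained by metis
      then show ?case
        by (simp add: penalized_def)
    qed
  qed
  also have "\<dots> = (\<Sum>n\<in>UNIV. w $ n * x $ n * (\<integral>\<omega>. b \<omega> $ n \<partial>M)) + (\<integral>\<omega>. \<phi> (\<xi> s \<omega>, b \<omega>) \<partial>M)"
    using assms by (simp add: integrable_decision integrable_cost)
  finally show ?thesis .
qed

text \<open>By independence and Fubini the state \<open>X\<close> can be held fixed while the data
  of period \<open>t\<close> are averaged, and \<open>least_penalized_mean_le\<close> applies. Its
  bound is affine in the state, so only the mean of \<open>X\<close> remains. The product of means
  does not come from independence of \<open>X\<close> and \<open>b\<close>.\<close>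

lemma penalized_mean_le:
  assumes X: "X \<in> borel_measurable (vimage_algebra (space M) (\<lambda>\<omega>. \<lambda>i\<in>I. \<xi> i \<omega>) (Pi\<^sub>M I (\<lambda>_. borel)))"
    and t: "t \<notin> I" and XM: "X \<in> borel_measurable M"
    and P: "compact P" "AE \<omega> in M. X \<omega> \<in> P"
    and u: "decision t u"
      "AE \<omega> in M. \<forall>u'. (\<xi> t \<omega>, u') \<in> G \<longrightarrow> penalized ((X \<omega>, \<xi> t \<omega>), u \<omega>) \<le> penalized ((X \<omega>, \<xi> t \<omega>), u')"
    and b: "decision s b"
  shows "(\<integral>\<omega>. (\<Sum>n\<in>UNIV. w $ n * X \<omega> $ n * u \<omega> $ n) + \<phi> (\<xi> t \<omega>, u \<omega>) \<partial>M) \<le>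
    (\<Sum>n\<in>UNIV. w $ n * (\<integral>\<omega>. X \<omega> $ n \<partial>M) * (\<integral>\<omega>. b \<omega> $ n \<partial>M)) + (\<integral>\<omega>. \<phi> (\<xi> s \<omega>, b \<omega>) \<partial>M)"
proof -
  note [measurable] = XM
  let ?D = "distr M borel X" and ?E = "distr M borel (\<xi> t)"
  interpret D: prob_space ?D by (rule prob_space_distr) fact
  interpret E: prob_space ?E by (rule prob_space_distr) simp
  interpret DE: pair_prob_space ?D ?E ..
  have pair: "distr M (borel \<Otimes>\<^sub>M borel) (\<lambda>\<omega>. (X \<omega>, \<xi> t \<omega>)) = ?D \<Otimes>\<^sub>M ?E"
    by (rule distr_pair_past[OF indep X t])
  have meas: "least_penalized \<in> borel_measurable (borel \<Otimes>\<^sub>M borel)"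
    by (simp add: borel_prod)
  obtain B where B: "\<And>x z u. x \<in> P \<Longrightarrow> z \<in> Z \<Longrightarrow> (z, u) \<in> G \<Longrightarrow> \<bar>least_penalized (x, z)\<bar> \<le> B"
    using penalized_bounded[OF P(1)] by metis
  have "integrable M (\<lambda>\<omega>. least_penalized (X \<omega>, \<xi> t \<omega>))"
  proof (rule integrable_const_bound[of _ B])
    show "AE \<omega> in M. norm (least_penalized (X \<omega>, \<xi> t \<omega>)) \<le> B"
      using AE_decision[OF u(1)] P(2) by eventually_elim (use B in auto)
    show "(\<lambda>\<omega>. least_penalized (X \<omega>, \<xi> t \<omega>)) \<in> borel_measurable M"
      by (rule measurable_compose[OF _ meas]) simp
  qed
  then have int: "integrable (?D \<Otimes>\<^sub>M ?E) least_penalized"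
    unfolding pair[symmetric] by (subst integrable_distr_eq) (use meas in auto)
  have intX: "integrable M (\<lambda>\<omega>. X \<omega> $ n)" for n
    by (rule integrable_continuous_compact[OF _ P(1) XM P(2)]) (intro continuous_intros)
  have intX': "integrable ?D (\<lambda>x. x $ n)" for n
    by (subst integrable_distr_eq) (use intX in auto)
  \<comment> \<open>Minimality of \<open>u\<close> replaces its penalized cost by the value
    function, which depends on state and data alone.\<close>
  have "(\<integral>\<omega>. (\<Sum>n\<in>UNIV. w $ n * X \<omega> $ n * u \<omega> $ n) + \<phi> (\<xi> t \<omega>, u \<omega>) \<partial>M) =
      (\<integral>\<omega>. least_penalized (X \<omega>, \<xi> t \<omega>) \<partial>M)"
  proof (rule integral_cong_AE)
    show "(\<lambda>\<omega>. (\<Sum>n\<in>UNIV. w $ n * X \<omega> $ n * u \<omega> $ n) + \<phi> (\<xi> t \<omega>, u \<omega>)) \<in> borel_measurable M"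
      using decision_measurable[OF u(1)] integrable_cost[OF u(1)] by measurable
    show "(\<lambda>\<omega>. least_penalized (X \<omega>, \<xi> t \<omega>)) \<in> borel_measurable M"
      by (rule measurable_compose[OF _ meas]) simp
    show "AE \<omega> in M. (\<Sum>n\<in>UNIV. w $ n * X \<omega> $ n * u \<omega> $ n) + \<phi> (\<xi> t \<omega>, u \<omega>) = least_penalized (X \<omega>, \<xi> t \<omega>)"
      using AE_decision[OF u(1)] u(2)
    proof eventually_elim
      case (elim \<omega>)
      then show ?case
        using least_penalized_eq[of "\<xi> t \<omega>" "u \<omega>" "X \<omega>"] by (simp add: penalized_def)
    qed
  qed
  also have "\<dots> = integral\<^sup>L (?D \<Otimes>\<^sub>M ?E) least_penalized"
    unfolding pair[symmetric] by (rule integral_distr[symmetric]) (use meas in auto)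
  also have "\<dots> = (\<integral>x. (\<integral>z. least_penalized (x, z) \<partial>?E) \<partial>?D)"
    by (rule DE.integral_fst'[OF int, symmetric])
  also have "\<dots> \<le> (\<integral>x. (\<Sum>n\<in>UNIV. w $ n * x $ n * (\<integral>\<omega>. b \<omega> $ n \<partial>M)) + (\<integral>\<omega>. \<phi> (\<xi> s \<omega>, b \<omega>) \<partial>M) \<partial>?D)"
  proof (rule integral_mono_AE)
    show "integrable ?D (\<lambda>x. \<integral>z. least_penalized (x, z) \<partial>?E)"
      by (rule DE.integrable_fst'[OF int])
    show "integrable ?D (\<lambda>x. (\<Sum>n\<in>UNIV. w $ n * x $ n * (\<integral>\<omega>. b \<omega> $ n \<partial>M)) + (\<integral>\<omega>. \<phi> (\<xi> s \<omega>, b \<omega>) \<partial>M))"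
      by (intro Bochner_Integration.integrable_add Bochner_Integration.integrable_sum
          integrable_mult_left integrable_mult_right intX' D.integrable_const)
  qed (auto intro!: least_penalized_mean_le[OF b])
  also have "\<dots> = (\<Sum>n\<in>UNIV. w $ n * (\<lambda>n. \<integral>x. x $ n \<partial>?D) n * (\<integral>\<omega>. b \<omega> $ n \<partial>M)) + (\<integral>\<omega>. \<phi> (\<xi> s \<omega>, b \<omega>) \<partial>M)"
    using intX' D.prob_space by simp
  also have "(\<lambda>n. \<integral>x. x $ n \<partial>?D) = (\<lambda>n. \<integral>\<omega>. X \<omega> $ n \<partial>M)"
    by (intro ext integral_distr) simp_all
  finally show ?thesis .
qed

end

section \<open>Long-run average costs and the drift argument\<close>

lemma convergent_mean_cost_LIMSEQ:
  assumes "convergent (mean_cost M f b)"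
  shows "mean_cost M f b \<longlonglongrightarrow> long_run_cost M f b"
  using assms by (simp add: convergent_LIMSEQ_iff long_run_cost_def)

context iid_control
begin

text \<open>One bound serves all decision sequences, since costs are bounded on
  \<open>Z \<times> U\<close>. It is what makes the real infimum of the offline problem
  meaningful.\<close>

lemma long_run_cost_bounded_below:
  obtains B where "\<And>b. (\<And>t. decision t (b t)) \<Longrightarrow> convergent (mean_cost M (\<lambda>t \<omega> u. \<phi> (\<xi> t \<omega>, u)) b) \<Longrightarrow>
    B \<le> long_run_cost M (\<lambda>t \<omega> u. \<phi> (\<xi> t \<omega>, u)) b"
proof -
  let ?mc = "mean_cost M (\<lambda>t \<omega> u. \<phi> (\<xi> t \<omega>, u))"
  obtain B where B: "\<And>z u. z \<in> Z \<Longrightarrow> u \<in> U \<Longrightarrow> \<bar>\<phi> (z, u)\<bar> \<le> B"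
    using cost_bounded by blast
  have "- B \<le> long_run_cost M (\<lambda>t \<omega> u. \<phi> (\<xi> t \<omega>, u)) b"
    if b: "\<And>t. decision t (b t)" and conv: "convergent (?mc b)" for b
  proof (rule LIMSEQ_le_const[OF convergent_mean_cost_LIMSEQ[OF conv]], intro exI[of _ 1] allI impI)
    \<comment> \<open>\<open>T = 0\<close> is left out because \<open>mean_cost\<close> divides by
      \<open>T\<close>.\<close>
    fix T :: nat assume T: "1 \<le> T"
    have "- B \<le> (\<integral>\<omega>. \<phi> (\<xi> t \<omega>, b t \<omega>) \<partial>M)" for t
    proof (rule integral_ge_const[OF integrable_cost[OF b]])
      show "AE \<omega> in M. - B \<le> \<phi> (\<xi> t \<omega>, b t \<omega>)"
        using AE_decision[OF b[of t]]
      proof eventually_elim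
        case (elim \<omega>)
        then show ?case
          using B[of "\<xi> t \<omega>" "b t \<omega>"] by linarith
      qed
    qed
    then have "(\<Sum>t<T. - B) \<le> (\<Sum>t<T. \<integral>\<omega>. \<phi> (\<xi> t \<omega>, b t \<omega>) \<partial>M)"
      by (intro sum_mono)
    with T show "- B \<le> ?mc b T"
      by (simp add: mean_cost_def field_simps)
  qed
  then show thesis
    by (rule that)
qed

text \<open>The index set stops before \<open>t\<close>, so that \<open>distr_pair_past\<close>
  applies with \<open>j = t\<close>. In period \<open>0\<close> it is empty and the state is the
  constant \<open>s0\<close>; otherwise it is the history up to the preceding period.\<close>

lemma soc_measurable_past:
  assumes "\<And>t. b t \<in> borel_measurable (history M \<xi> t)"
  shows "soc s0 b t \<in> borel_measurable
    (vimage_algebra (space M) (\<lambda>\<omega>. \<lambda>i\<in>{..<t}. \<xi> i \<omega>) (Pi\<^sub>M {..<t} (\<lambda>_. borel)))"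
proof (cases t)
  case 0
  then show ?thesis
    by (intro borel_measurable_soc) auto
next
  case (Suc m)
  have "soc s0 b t \<in> borel_measurable (history M \<xi> m)"
    using measurable_history_mono[of _ m M \<xi> borel] assms Suc
    by (intro borel_measurable_soc) (auto simp: less_Suc_eq_le)
  then show ?thesis
    by (simp add: Suc history_def lessThan_Suc_atMost)
qed

text \<open>Here \<open>a\<close> is the causal greedy sequence and \<open>b\<close> any competitor.
  The averages use separate horizons, \<open>T'\<close> for \<open>a\<close> and \<open>T\<close>
  for \<open>b\<close>; the limit in \<open>T'\<close> is taken first, with \<open>T\<close>
  fixed.\<close>

lemma drift_plus_penalty:
  assumes adapted: "\<And>t. a t \<in> borel_measurable (history M \<xi> t)"
    and a: "\<And>t. decision t (a t)" "AE \<omega> in M. \<forall>t. soc s0 a t \<omega> \<in> {s_lo..s_hi}"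
    and greedy: "AE \<omega> in M. \<forall>t u. (\<xi> t \<omega>, u) \<in> G \<longrightarrow>
      penalized ((soc s0 a t \<omega> + \<gamma>, \<xi> t \<omega>), a t \<omega>) \<le> penalized ((soc s0 a t \<omega> + \<gamma>, \<xi> t \<omega>), u)"
    and b: "\<And>t. decision t (b t)" "AE \<omega> in M. \<forall>t. soc s0 b t \<omega> \<in> {s_lo..s_hi}"
    and s0: "s0 \<in> {s_lo..s_hi}"
    and K: "\<And>u. u \<in> U \<Longrightarrow> 1 / 2 * (\<Sum>n\<in>UNIV. w $ n * (u $ n)\<^sup>2) \<le> K"
    and conv: "convergent (mean_cost M (\<lambda>t \<omega> u. \<phi> (\<xi> t \<omega>, u)) a)"
      "convergent (mean_cost M (\<lambda>t \<omega> u. \<phi> (\<xi> t \<omega>, u)) b)"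
  shows "long_run_cost M (\<lambda>t \<omega> u. \<phi> (\<xi> t \<omega>, u)) a \<le> long_run_cost M (\<lambda>t \<omega> u. \<phi> (\<xi> t \<omega>, u)) b + K"
proof -
  define mc where "mc = mean_cost M (\<lambda>t \<omega> u. \<phi> (\<xi> t \<omega>, u))"
  define x where "x t \<omega> = soc s0 a t \<omega> + \<gamma>" for t \<omega>
  define V where "V v = 1 / 2 * (\<Sum>n\<in>UNIV. w $ n * (v $ n)\<^sup>2)" for v :: "real ^ 'n"
  define L where "L t = (\<integral>\<omega>. V (x t \<omega>) \<partial>M)" for t
  \<comment> \<open>\<open>c n\<close> bounds the absolute queue of user \<open>n\<close>, which
    lies between the shifted state limits. \<open>D\<close> bounds the penalty accumulated over any
    number of offline periods.\<close>
  define c where "c n = \<bar>s_lo $ n + \<gamma> $ n\<bar> + \<bar>s_hi $ n + \<gamma> $ n\<bar>" for n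
  define D where "D = (\<Sum>n\<in>UNIV. w $ n * c n * (s_hi $ n - s_lo $ n))"
  define P where "P = {s_lo + \<gamma>..s_hi + \<gamma>}"
  have P: "compact P"
    by (simp add: P_def)
  have x_past: "x t \<in> borel_measurable (vimage_algebra (space M) (\<lambda>\<omega>. \<lambda>i\<in>{..<t}. \<xi> i \<omega>) (Pi\<^sub>M {..<t} (\<lambda>_. borel)))" for t
    unfolding x_def using soc_measurable_past[OF adapted] by simp
  have x_meas: "x t \<in> borel_measurable M" for t
    unfolding x_def using borel_measurable_soc[of t a M] a(1) decision_measurable by simp
  have x_P: "AE \<omega> in M. x t \<omega> \<in> P" for t
    using a(2) by eventually_elim (simp add: x_def P_def)
  have int_V: "integrable M (\<lambda>\<omega>. V (x t \<omega>))" for t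
    by (rule integrable_continuous_compact[OF _ P x_meas x_P]) (auto simp: V_def intro!: continuous_intros)
  have int_x: "integrable M (\<lambda>\<omega>. x t \<omega> $ n)" for t n
    by (rule integrable_continuous_compact[OF _ P x_meas x_P]) (auto intro!: continuous_intros)
  have int_pen: "integrable M (\<lambda>\<omega>. (\<Sum>n\<in>UNIV. w $ n * x t \<omega> $ n * a t \<omega> $ n) + \<phi> (\<xi> t \<omega>, a t \<omega>))" for t
  proof (intro Bochner_Integration.integrable_add integrable_cost a)
    have "(\<lambda>\<omega>. (x t \<omega>, a t \<omega>)) \<in> borel_measurable M"
      using x_meas decision_measurable[OF a(1)] by (simp add: borel_prod[symmetric])
    moreover have "AE \<omega> in M. (x t \<omega>, a t \<omega>) \<in> P \<times> U"
      using x_P[of t] AE_decision[OF a(1)[of t]] by eventually_elim simp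
    moreover have "continuous_on UNIV (\<lambda>p :: (real ^ 'n) \<times> (real ^ 'n). \<Sum>n\<in>UNIV. w $ n * fst p $ n * snd p $ n)"
      by (intro continuous_intros)
    ultimately show "integrable M (\<lambda>\<omega>. \<Sum>n\<in>UNIV. w $ n * x t \<omega> $ n * a t \<omega> $ n)"
      using integrable_continuous_compact[OF _ compact_Times[OF P compact_U]] by fastforce
  qed
  have drift: "(\<integral>\<omega>. \<phi> (\<xi> t \<omega>, a t \<omega>) \<partial>M) + L (Suc t) - L t - K \<le>
      (\<integral>\<omega>. (\<Sum>n\<in>UNIV. w $ n * x t \<omega> $ n * a t \<omega> $ n) + \<phi> (\<xi> t \<omega>, a t \<omega>) \<partial>M)" for t
  proof -
    have "(\<integral>\<omega>. \<phi> (\<xi> t \<omega>, a t \<omega>) \<partial>M) + L (Suc t) - L t - K =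
        (\<integral>\<omega>. \<phi> (\<xi> t \<omega>, a t \<omega>) + V (x (Suc t) \<omega>) - V (x t \<omega>) - K \<partial>M)"
      using integrable_cost[OF a(1)] int_V by (simp add: L_def prob_space)
    also have "\<dots> \<le> (\<integral>\<omega>. (\<Sum>n\<in>UNIV. w $ n * x t \<omega> $ n * a t \<omega> $ n) + \<phi> (\<xi> t \<omega>, a t \<omega>) \<partial>M)"
    proof (rule integral_mono_AE[OF _ int_pen])
      show "AE \<omega> in M. \<phi> (\<xi> t \<omega>, a t \<omega>) + V (x (Suc t) \<omega>) - V (x t \<omega>) - K \<le>
          (\<Sum>n\<in>UNIV. w $ n * x t \<omega> $ n * a t \<omega> $ n) + \<phi> (\<xi> t \<omega>, a t \<omega>)"
        using AE_decision[OF a(1)[of t]]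
      proof eventually_elim
        case (elim \<omega>)
        \<comment> \<open>Expanding the square produces the penalty term exactly; what is left over
          is quadratic in the charge and bounded by \<open>K\<close>.\<close>
        have "V (x (Suc t) \<omega>) - V (x t \<omega>) =
            (\<Sum>n\<in>UNIV. w $ n * x t \<omega> $ n * a t \<omega> $ n) + V (a t \<omega>)"
          unfolding V_def right_diff_distrib[symmetric] sum_distrib_left sum_subtractf[symmetric] sum.distrib[symmetric]
          by (rule sum.cong) (auto simp: x_def power2_eq_square algebra_simps)
        moreover have "V (a t \<omega>) \<le> K"
          unfolding V_def by (rule K) (use elim in simp)
        ultimately show ?case
          by linarith
      qed
    qed (use integrable_cost[OF a(1)] int_V in simp)
    finally show ?thesis .
  qed
  have x_mean: "\<bar>\<integral>\<omega>. x t \<omega> $ n \<partial>M\<bar> \<le> c n" for t n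
  proof -
    have bd: "AE \<omega> in M. s_lo $ n + \<gamma> $ n \<le> x t \<omega> $ n" "AE \<omega> in M. x t \<omega> $ n \<le> s_hi $ n + \<gamma> $ n"
      using x_P[of t] by (eventually_elim, simp add: P_def less_eq_vec_def)+
    have "s_lo $ n + \<gamma> $ n \<le> (\<integral>\<omega>. x t \<omega> $ n \<partial>M)"
      by (rule integral_ge_const[OF int_x bd(1)])
    moreover have "(\<integral>\<omega>. x t \<omega> $ n \<partial>M) \<le> s_hi $ n + \<gamma> $ n"
      by (rule integral_le_const[OF int_x bd(2)])
    ultimately show ?thesis
      by (auto simp: c_def)
  qed
  \<comment> \<open>The charges before \<open>T\<close> add up to the change of state since
    \<open>s0\<close>. Both states lie in the same interval, so its width is a bound for every
    \<open>T\<close>.\<close>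
  have b_mean: "\<bar>\<Sum>s<T. \<integral>\<omega>. b s \<omega> $ n \<partial>M\<bar> \<le> s_hi $ n - s_lo $ n" for T n
  proof -
    have int: "integrable M (\<lambda>\<omega>. \<Sum>s<T. b s \<omega> $ n)"
      using integrable_decision[OF b(1)] by simp
    have eq: "(\<Sum>s<T. \<integral>\<omega>. b s \<omega> $ n \<partial>M) = (\<integral>\<omega>. (\<Sum>s<T. b s \<omega> $ n) \<partial>M)"
      using integrable_decision[OF b(1)] by simp
    have bd: "AE \<omega> in M. s_lo $ n - s0 $ n \<le> (\<Sum>s<T. b s \<omega> $ n) \<and> (\<Sum>s<T. b s \<omega> $ n) \<le> s_hi $ n - s0 $ n"
      using b(2)
    proof eventually_elim
      case (elim \<omega>)
      then have "s_lo $ n \<le> soc s0 b T \<omega> $ n" "soc s0 b T \<omega> $ n \<le> s_hi $ n"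
        by (auto simp: less_eq_vec_def)
      then show ?case
        by (auto simp: soc_eq_sum)
    qed
    have "s_lo $ n - s0 $ n \<le> (\<integral>\<omega>. (\<Sum>s<T. b s \<omega> $ n) \<partial>M)"
      by (rule integral_ge_const[OF int]) (use bd in \<open>auto elim!: eventually_mono\<close>)
    moreover have "(\<integral>\<omega>. (\<Sum>s<T. b s \<omega> $ n) \<partial>M) \<le> s_hi $ n - s0 $ n"
      by (rule integral_le_const[OF int]) (use bd in \<open>auto elim!: eventually_mono\<close>)
    moreover have "s_lo $ n \<le> s0 $ n" "s0 $ n \<le> s_hi $ n"
      using s0 by (auto simp: less_eq_vec_def)
    ultimately show ?thesis
      unfolding eq by linarith
  qed
  have step: "(\<integral>\<omega>. \<phi> (\<xi> t \<omega>, a t \<omega>) \<partial>M) + L (Suc t) - L t \<le> K + D / real T + mc b T" if T: "0 < T" for t T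
  proof -
    \<comment> \<open>\<open>l\<close> does not depend on \<open>s\<close>, so summing the
      comparison over \<open>s < T\<close> gives \<open>real T * l\<close> on the left.\<close>
    define l where "l = (\<integral>\<omega>. \<phi> (\<xi> t \<omega>, a t \<omega>) \<partial>M) + L (Suc t) - L t - K"
    have "l \<le> (\<Sum>n\<in>UNIV. w $ n * (\<integral>\<omega>. x t \<omega> $ n \<partial>M) * (\<integral>\<omega>. b s \<omega> $ n \<partial>M)) + (\<integral>\<omega>. \<phi> (\<xi> s \<omega>, b s \<omega>) \<partial>M)" for s
      unfolding l_def
      by (rule order_trans[OF drift penalized_mean_le[OF x_past _ x_meas P x_P a(1) _ b(1)]])
        (use greedy in \<open>auto simp: x_def elim!: eventually_mono\<close>)
    then have "(\<Sum>s<T. l) \<le> (\<Sum>s<T. (\<Sum>n\<in>UNIV. w $ n * (\<integral>\<omega>. x t \<omega> $ n \<partial>M) * (\<integral>\<omega>. b s \<omega> $ n \<partial>M)) +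
        (\<integral>\<omega>. \<phi> (\<xi> s \<omega>, b s \<omega>) \<partial>M))"
      by (intro sum_mono)
    \<comment> \<open>After exchanging the sums, the mean queue of the fixed period \<open>t\<close>
      multiplies the accumulated mean charge, to which \<open>b_mean\<close> applies.\<close>
    also have "\<dots> = (\<Sum>n\<in>UNIV. w $ n * (\<integral>\<omega>. x t \<omega> $ n \<partial>M) * (\<Sum>s<T. \<integral>\<omega>. b s \<omega> $ n \<partial>M)) + real T * mc b T"
      using T unfolding sum.distrib sum.swap[of _ UNIV] sum_distrib_left
      by (simp add: mc_def mean_cost_def)
    also have "(\<Sum>n\<in>UNIV. w $ n * (\<integral>\<omega>. x t \<omega> $ n \<partial>M) * (\<Sum>s<T. \<integral>\<omega>. b s \<omega> $ n \<partial>M)) \<le> D"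
      unfolding D_def
    proof (rule sum_mono)
      fix n
      have "(\<integral>\<omega>. x t \<omega> $ n \<partial>M) * (\<Sum>s<T. \<integral>\<omega>. b s \<omega> $ n \<partial>M) \<le> c n * (s_hi $ n - s_lo $ n)"
        by (rule order_trans[OF abs_ge_self])
          (unfold abs_mult, intro mult_mono x_mean b_mean, auto simp: c_def)
      then show "w $ n * (\<integral>\<omega>. x t \<omega> $ n \<partial>M) * (\<Sum>s<T. \<integral>\<omega>. b s \<omega> $ n \<partial>M) \<le> w $ n * c n * (s_hi $ n - s_lo $ n)"
        using w_pos[of n] by (simp add: mult.assoc)
    qed
    finally have "real T * l \<le> D + real T * mc b T"
      by simp
    then have "l \<le> D / real T + mc b T"
      using T by (simp add: field_simps)
    then show ?thesis
      by (simp add: l_def)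
  qed
  have L_nonneg: "0 \<le> L t" for t
    unfolding L_def V_def using w_pos
    by (intro integral_nonneg_AE AE_I2 mult_nonneg_nonneg sum_nonneg) (auto intro: less_imp_le)
  have lim_a: "mc a \<longlonglongrightarrow> long_run_cost M (\<lambda>t \<omega> u. \<phi> (\<xi> t \<omega>, u)) a"
    and lim_b: "mc b \<longlonglongrightarrow> long_run_cost M (\<lambda>t \<omega> u. \<phi> (\<xi> t \<omega>, u)) b"
    unfolding mc_def by (intro convergent_mean_cost_LIMSEQ conv)+
  have bound: "long_run_cost M (\<lambda>t \<omega> u. \<phi> (\<xi> t \<omega>, u)) a \<le> K + D / real T + mc b T" if T: "0 < T" for T
  proof (rule LIMSEQ_le[OF lim_a])
    show "(\<lambda>T'. K + D / real T + mc b T + L 0 / real T') \<longlonglongrightarrow> K + D / real T + mc b T"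
      using tendsto_add[OF tendsto_const lim_const_over_n] by fastforce
    show "\<exists>N. \<forall>T'\<ge>N. mc a T' \<le> K + D / real T + mc b T + L 0 / real T'"
    proof (intro exI[of _ 1] allI impI)
      fix T' :: nat assume T': "1 \<le> T'"
      \<comment> \<open>The drift telescopes to \<open>L T' - L 0\<close>. The nonnegative
        \<open>L T'\<close> is dropped, and \<open>L 0 / real T'\<close> survives the
        division.\<close>
      have "(\<Sum>t<T'. (\<integral>\<omega>. \<phi> (\<xi> t \<omega>, a t \<omega>) \<partial>M) + (L (Suc t) - L t)) \<le> (\<Sum>t<T'. K + D / real T + mc b T)"
        using step[OF T] by (intro sum_mono) (simp add: add_diff_eq)
      then have "(\<Sum>t<T'. \<integral>\<omega>. \<phi> (\<xi> t \<omega>, a t \<omega>) \<partial>M) + L T' - L 0 \<le> real T' * (K + D / real T + mc b T)"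
        unfolding sum.distrib sum_lessThan_telescope by (simp add: algebra_simps)
      with L_nonneg[of T'] have "(\<Sum>t<T'. \<integral>\<omega>. \<phi> (\<xi> t \<omega>, a t \<omega>) \<partial>M) \<le> real T' * (K + D / real T + mc b T) + L 0"
        by linarith
      then have "(\<Sum>t<T'. \<integral>\<omega>. \<phi> (\<xi> t \<omega>, a t \<omega>) \<partial>M) / real T' \<le> (real T' * (K + D / real T + mc b T) + L 0) / real T'"
        by (intro divide_right_mono) auto
      then show "mc a T' \<le> K + D / real T + mc b T + L 0 / real T'"
        using T' by (simp add: mc_def mean_cost_def add_divide_distrib)
    qed
  qed
  \<comment> \<open>Now the horizon of the competitor grows and the term with \<open>D\<close>
    vanishes.\<close>
  have "(\<lambda>T. K + D / real T + mc b T) \<longlonglongrightarrow> K + 0 + long_run_cost M (\<lambda>t \<omega> u. \<phi> (\<xi> t \<omega>, u)) b"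
    by (intro tendsto_intros lim_b lim_const_over_n)
  then have "long_run_cost M (\<lambda>t \<omega> u. \<phi> (\<xi> t \<omega>, u)) a \<le> K + 0 + long_run_cost M (\<lambda>t \<omega> u. \<phi> (\<xi> t \<omega>, u)) b"
    by (rule LIMSEQ_le_const) (use bound in \<open>auto intro!: exI[of _ 1]\<close>)
  then show ?thesis
    by simp
qed

end

section \<open>The battery problem as an instance\<close>

text \<open>In the order of the components of \<open>\<xi>\<close>: $r, c_0, c_p, c_r, \ell, q$.\<close>

type_synonym 'n data = "real \<times> real \<times> real \<times> real \<times> (real ^ 'n) \<times> (real ^ 'n)"

text \<open>For \<open>r\<close> in \<open>{-1, 1}\<close> the sign rule amounts to
  \<open>0 \<le> r * b $ n\<close>, a weak inequality between continuous functions like the others.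
  For other \<open>r\<close> the implications are vacuous and closedness may fail, so the graph
  includes the restriction on \<open>r\<close>.\<close>

lemma closed_admissible_graph:
  fixes R X :: "real ^ 'n ^ 'n"
  shows "closed {(z :: 'n data, b).
    case z of (r, c0, cp, cr, l, q) \<Rightarrow> r \<in> {-1, 1} \<and> b \<in> admissible R X \<alpha> \<beta> b_lo b_hi r l q}"
proof -
  \<comment> \<open>With \<open>p = (z, b)\<close>, \<open>fst (fst p)\<close> is the signal, the
    chain of \<open>fst\<close> and four \<open>snd\<close> before \<open>fst p\<close> the active
    load, and that of five \<open>snd\<close> the reactive load.\<close>
  have "{(z :: 'n data, b).
      case z of (r, c0, cp, cr, l, q) \<Rightarrow> r \<in> {-1, 1} \<and> b \<in> admissible R X \<alpha> \<beta> b_lo b_hi r l q} =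
    {p. (fst (fst p) = -1 \<or> fst (fst p) = 1) \<and>
      (\<forall>n. b_lo $ n \<le> snd p $ n) \<and> (\<forall>n. snd p $ n \<le> b_hi $ n) \<and>
      (\<forall>n. \<alpha> \<le> - (\<Sum>j\<in>UNIV. R $ n $ j * (fst (snd (snd (snd (snd (fst p))))) $ j + snd p $ j))
        - (\<Sum>j\<in>UNIV. X $ n $ j * snd (snd (snd (snd (snd (fst p))))) $ j)) \<and>
      (\<forall>n. - (\<Sum>j\<in>UNIV. R $ n $ j * (fst (snd (snd (snd (snd (fst p))))) $ j + snd p $ j))
        - (\<Sum>j\<in>UNIV. X $ n $ j * snd (snd (snd (snd (snd (fst p))))) $ j) \<le> \<beta>) \<and>
      (\<forall>n. 0 \<le> fst (fst p) * snd p $ n)}"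
    by (auto simp: admissible_def less_eq_vec_def matrix_vector_mult_def)
  also have "closed \<dots>"
    by (intro closed_Collect_conj closed_Collect_disj closed_Collect_all closed_Collect_le closed_Collect_eq
        continuous_intros)
  finally show ?thesis .
qed

lemma continuous_aggregate_cost:
  "continuous_on UNIV (\<lambda>(z :: 'n::finite data, b).
    case z of (r, c0, cp, cr, l, q) \<Rightarrow> aggregate_cost r c0 cp cr l b)"
  unfolding aggregate_cost_def Let_def case_prod_unfold by (intro continuous_intros) auto

lemma sum_squares_le:
  fixes w :: "real ^ 'n"
  assumes "\<And>n. 0 < w $ n" "u \<in> {b_lo..b_hi}"
  shows "1 / 2 * (\<Sum>n\<in>UNIV. w $ n * (u $ n)\<^sup>2) \<le> 1 / 2 * (\<Sum>n\<in>UNIV. w $ n * max ((b_hi $ n)\<^sup>2) ((b_lo $ n)\<^sup>2))"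
proof -
  have "(u $ n)\<^sup>2 \<le> max ((b_hi $ n)\<^sup>2) ((b_lo $ n)\<^sup>2)" for n
  proof (cases "0 \<le> u $ n")
    case True
    then have "(u $ n)\<^sup>2 \<le> (b_hi $ n)\<^sup>2"
      using assms(2) by (intro power_mono) (auto simp: less_eq_vec_def)
    then show ?thesis by simp
  next
    case False
    \<comment> \<open>Both sides are negated so that the bases are nonnegative before
      squaring.\<close>
    then have "(- u $ n)\<^sup>2 \<le> (- b_lo $ n)\<^sup>2"
      using assms(2) by (intro power_mono) (auto simp: less_eq_vec_def)
    then show ?thesis by simp
  qed
  then show ?thesis
    using assms(1) by (intro mult_left_mono sum_mono) (auto intro: less_imp_le)
qed

theorem theorem3:
  fixes M :: "'w measure"
    and src dst :: "'n::finite \<Rightarrow> 'n option"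
    and \<rho> \<chi>l :: "real ^ 'n"
    and A R X :: "real ^ 'n ^ 'n"
    and \<alpha> \<beta> :: real
    and r c0 cp cr :: "nat \<Rightarrow> 'w \<Rightarrow> real"
    and l q :: "nat \<Rightarrow> 'w \<Rightarrow> real ^ 'n"
    and \<xi> :: "nat \<Rightarrow> 'w \<Rightarrow> real \<times> real \<times> real \<times> real \<times> (real ^ 'n) \<times> (real ^ 'n)"
    and l_lo l_hi q_lo q_hi b_lo b_hi s_lo s_hi s0 w \<gamma> :: "real ^ 'n"
    and c0_lo c0_hi cp_lo cp_hi cr_lo cr_hi K :: real
    and g_lo g_hi \<delta> :: "'n \<Rightarrow> real"
    and C :: "nat \<Rightarrow> 'w \<Rightarrow> (real ^ 'n) set"
    and f :: "nat \<Rightarrow> 'w \<Rightarrow> real ^ 'n \<Rightarrow> real"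
    and b_rt :: "nat \<Rightarrow> 'w \<Rightarrow> real ^ 'n"
  assumes prob: "prob_space M"
    and grid: "radial src dst" "\<And>k. 0 < \<rho> $ k" "\<And>k. 0 < \<chi>l $ k"
    and A_eq: "A = incidence src dst"
    and R_eq: "R = sensitivity A \<rho>"
    and X_eq: "X = sensitivity A \<chi>l"
    and \<xi>_eq: "\<xi> = (\<lambda>t \<omega>. (r t \<omega>, c0 t \<omega>, cp t \<omega>, cr t \<omega>, l t \<omega>, q t \<omega>))"
    and C_eq: "C = (\<lambda>t \<omega>. admissible R X \<alpha> \<beta> b_lo b_hi (r t \<omega>) (l t \<omega>) (q t \<omega>))"
    and f_eq: "f = (\<lambda>t \<omega>. aggregate_cost (r t \<omega>) (c0 t \<omega>) (cp t \<omega>) (cr t \<omega>) (l t \<omega>))"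
    and load_bounds: "AE \<omega> in M. \<forall>t. l_lo \<le> l t \<omega> \<and> l t \<omega> \<le> l_hi \<and> q_lo \<le> q t \<omega> \<and> q t \<omega> \<le> q_hi"
    and signal: "AE \<omega> in M. \<forall>t. r t \<omega> \<in> {-1, 1}"
    and price_bounds: "AE \<omega> in M. \<forall>t. c0_lo \<le> c0 t \<omega> \<and> c0 t \<omega> \<le> c0_hi \<and>
          cp_lo \<le> cp t \<omega> \<and> cp t \<omega> \<le> cp_hi \<and> cr_lo \<le> cr t \<omega> \<and> cr t \<omega> \<le> cr_hi"
    and price_nonneg: "0 \<le> c0_lo" "0 \<le> cp_lo" "0 \<le> cr_lo"
    and price_pos: "AE \<omega> in M. \<forall>t. \<forall>b\<in>C t \<omega>. 0 < c0 t \<omega> + cp t \<omega> * (\<Sum>i\<in>UNIV. (l t \<omega> + b) $ i)"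
    and charge_limits: "b_lo \<le> 0" "0 \<le> b_hi"
    and initial: "s_lo \<le> s0" "s0 \<le> s_hi"
    and a1: "\<And>n. s_hi $ n - s_lo $ n > b_hi $ n - b_lo $ n"
    and a2: "AE \<omega> in M. \<forall>t. vec \<alpha> \<le> - (R *v l t \<omega>) - X *v q t \<omega> \<and>
          - (R *v l t \<omega>) - X *v q t \<omega> \<le> vec \<beta>"
    and w_pos: "\<And>n. 0 < w $ n"
    and g_lo_eq: "g_lo = (\<lambda>n. c0_lo + cp_lo / real CARD('n) * (\<Sum>i\<in>UNIV. l_lo $ i)
          + cp_lo / real CARD('n) * l_lo $ n - cr_hi)"
    and g_hi_eq: "g_hi = (\<lambda>n. c0_hi + cp_hi / real CARD('n) * (\<Sum>i\<in>UNIV. l_hi $ i)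
          + cp_hi / real CARD('n) * l_hi $ n + cr_hi)"
    and \<delta>_eq: "\<delta> = (\<lambda>n. (s_hi $ n - s_lo $ n + b_lo $ n - b_hi $ n) / (g_hi n - g_lo n))"
    and \<delta>_pos: "\<And>n. 0 < \<delta> n"
    and tuning: "\<And>n. 1 \<le> w $ n * \<delta> n"
      "\<And>n. - g_lo n / w $ n + b_hi $ n - s_hi $ n \<le> \<gamma> $ n"
      "\<And>n. \<gamma> $ n \<le> - g_hi n / w $ n + b_lo $ n - s_lo $ n"
    and real_time: "real_time_decisions M \<xi> f C w \<gamma> s0 b_rt"
    and real_time_feasible: "offline_feasible M C s_lo s_hi s0 b_rt"
    and real_time_limit: "convergent (mean_cost M f b_rt)"
    and indep: "prob_space.indep_vars M (\<lambda>_. borel) \<xi> UNIV"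
    and ident: "\<And>t. distr M borel (\<xi> t) = distr M borel (\<xi> 0)"
    and K_eq: "K = 1 / 2 * (\<Sum>n\<in>UNIV. w $ n * max ((b_hi $ n)\<^sup>2) ((b_lo $ n)\<^sup>2))"
  shows "offline_value M f C s_lo s_hi s0 \<le> long_run_cost M f b_rt \<and>
         long_run_cost M f b_rt \<le> offline_value M f C s_lo s_hi s0 + K"
proof -
  interpret prob_space M by (rule prob)
  define \<phi> :: "'n data \<times> (real ^ 'n) \<Rightarrow> real"
    where "\<phi> = (\<lambda>(z, b). case z of (r, c0, cp, cr, l, q) \<Rightarrow> aggregate_cost r c0 cp cr l b)"
  define G :: "('n data \<times> (real ^ 'n)) set"
    where "G = {(z, b). case z of (r, c0, cp, cr, l, q) \<Rightarrow> r \<in> {-1, 1} \<and> b \<in> admissible R X \<alpha> \<beta> b_lo b_hi r l q}"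
  \<comment> \<open>The signal ranges over a whole interval here, which makes \<open>Z\<close> a
    product of intervals; its two values are enforced in \<open>G\<close>.\<close>
  define Z :: "'n data set"
    where "Z = {-1..1} \<times> {c0_lo..c0_hi} \<times> {cp_lo..cp_hi} \<times> {cr_lo..cr_hi} \<times> {l_lo..l_hi} \<times> {q_lo..q_hi}"
  interpret iid_control M \<xi> \<phi> G Z "{b_lo..b_hi}" w
  proof
    show "closed G"
      unfolding G_def by (rule closed_admissible_graph)
    show "continuous_on UNIV \<phi>"
      unfolding \<phi>_def by (rule continuous_aggregate_cost)
    show "snd ` G \<subseteq> {b_lo..b_hi}"
      by (auto simp: G_def admissible_def)
    show "compact Z"
      unfolding Z_def by (intro compact_Times compact_interval compact_Icc)
    show "AE \<omega> in M. \<forall>t. \<xi> t \<omega> \<in> Z"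
      using load_bounds signal price_bounds
    proof eventually_elim
      case (elim \<omega>)
      show ?case
      proof
        fix t
        have "r t \<omega> = -1 \<or> r t \<omega> = 1"
          using elim(2) by auto
        then show "\<xi> t \<omega> \<in> Z"
          using elim(1,3) by (auto simp: \<xi>_eq Z_def)
      qed
    qed
  qed (use indep ident w_pos in \<open>auto intro: compact_interval\<close>)
  have f: "f = (\<lambda>t \<omega> u. \<phi> (\<xi> t \<omega>, u))"
    by (simp add: f_eq \<phi>_def \<xi>_eq)
  \<comment> \<open>The equivalence holds almost surely only, since \<open>G\<close> also demands
    that the signal be \<open>-1\<close> or \<open>1\<close>.\<close>
  have C: "AE \<omega> in M. \<forall>t u. u \<in> C t \<omega> \<longleftrightarrow> (\<xi> t \<omega>, u) \<in> G"
    using signal by eventually_elim (auto simp: C_eq G_def \<xi>_eq)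
  have decision: "decision t (b t)" if "offline_feasible M C s_lo s_hi s0 b" for b t
  proof -
    have "AE \<omega> in M. \<forall>t. b t \<omega> \<in> C t \<omega>"
      using that by (auto simp: offline_feasible_def elim: eventually_mono)
    with C have "AE \<omega> in M. (\<xi> t \<omega>, b t \<omega>) \<in> G"
      by eventually_elim blast
    with that show ?thesis
      by (auto simp: decision_def offline_feasible_def)
  qed
  have soc: "AE \<omega> in M. \<forall>t. soc s0 b t \<omega> \<in> {s_lo..s_hi}" if "offline_feasible M C s_lo s_hi s0 b" for b
    using that by (auto simp: offline_feasible_def elim: eventually_mono)
  have greedy: "AE \<omega> in M. \<forall>t u. (\<xi> t \<omega>, u) \<in> G \<longrightarrow>
      penalized ((soc s0 b_rt t \<omega> + \<gamma>, \<xi> t \<omega>), b_rt t \<omega>) \<le> penalized ((soc s0 b_rt t \<omega> + \<gamma>, \<xi> t \<omega>), u)"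
    using real_time[unfolded real_time_decisions_def, THEN conjunct2] C
    by eventually_elim (simp add: is_arg_min_linorder penalized_def f)
  let ?B = "{b. offline_feasible M C s_lo s_hi s0 b \<and> convergent (mean_cost M f b)}"
  have rt: "b_rt \<in> ?B"
    using real_time_feasible real_time_limit by simp
  obtain B where B: "\<And>b. (\<And>t. decision t (b t)) \<Longrightarrow> convergent (mean_cost M f b) \<Longrightarrow>
      B \<le> long_run_cost M f b"
    using long_run_cost_bounded_below unfolding f by blast
  have "B \<le> long_run_cost M f b" if "b \<in> ?B" for b
    using that by (intro B decision) auto
  \<comment> \<open>A lower bound is what places the real infimum below the cost of the feasible
    \<open>b_rt\<close>.\<close>
  then have "bdd_below (long_run_cost M f ` ?B)"
    by (rule bdd_belowI2)
  with rt have "offline_value M f C s_lo s_hi s0 \<le> long_run_cost M f b_rt"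
    unfolding offline_value_def by (rule cINF_lower[rotated])
  \<comment> \<open>Each competitor is bounded separately, so no offline minimizer has to exist;
    \<open>b_rt\<close> shows that there is a competitor.\<close>
  moreover have "long_run_cost M f b_rt - K \<le> offline_value M f C s_lo s_hi s0"
    unfolding offline_value_def
  proof (rule cINF_greatest)
    fix b assume b: "b \<in> ?B"
    have "long_run_cost M f b_rt \<le> long_run_cost M f b + K"
      unfolding f
    proof (rule drift_plus_penalty[OF _ decision[of b_rt] soc[of b_rt] greedy decision[of b] soc[of b]])
      show "b_rt t \<in> borel_measurable (history M \<xi> t)" for t
        using real_time by (simp add: real_time_decisions_def)
      show "1 / 2 * (\<Sum>n\<in>UNIV. w $ n * (u $ n)\<^sup>2) \<le> K" if "u \<in> {b_lo..b_hi}" for u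
        unfolding K_eq by (rule sum_squares_le[OF w_pos that])
    qed (use b rt initial f in auto)
    then show "long_run_cost M f b_rt - K \<le> long_run_cost M f b"
      by simp
  qed (use rt in auto)
  ultimately show ?thesis
    by simp
qed

end
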